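(* Let $d\in\mathbb{N}$ and let $\xi,\xi_1,\xi_2,\ldots$ be i.i.d. random variables in $\mathbb{R}^d$ with $\mathbb{E}\|\xi\|<\infty$ and $\mathbb{E}\xi=\mu$. Let $S_0:=0$ and $S_n:=\sum_{i=1}^n\xi_i$. Then, as $n\to\infty$, as elements of $(\mathfrak{C}_0^d,\rho_H)$, $$n^{-1}\operatorname{hull}\{S_0,\ldots,S_n\}\to I_\mu[0,1]\quad\text{almost surely},$$ where $I_\mu[0,1]:=\{\mu t:t\in[0,1]\}$.
   Context: $\operatorname{hull}A$ is the convex hull of $A\subseteq\mathbb{R}^d$. $\mathfrak{C}_0^d$ is the set of convex compact subsets of $\mathbb{R}^d$ containing $0$, and $\rho_H$ is the Hausdorff distance $\rho_H(A,B):=\max\{\sup_{x\in A}\inf_{y\in B}\|x-y\|,\ \sup_{y\in B}\inf_{x\in A}\|x-y\|\}$. Almost sure convergence $X_n\to X$ in a metric space $(S,\rho)$ means $\rho(X_n,X)\to0$ almost surely. *)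

theory Defs
  imports "HOL-Probability.Probability"
begin

text \<open>The real-valued suprema and infima below are meaningful for nonempty bounded sets, in
  particular on \<open>convex_compact0\<close>.\<close>

definition hausdorff_dist :: "'a::real_normed_vector set \<Rightarrow> 'a set \<Rightarrow> real" where
  "hausdorff_dist A B =
     max (SUP x\<in>A. INF y\<in>B. norm (x - y)) (SUP y\<in>B. INF x\<in>A. norm (x - y))"

definition convex_compact0 :: "'a::real_normed_vector set set" where
  "convex_compact0 = {A. convex A \<and> compact A \<and> 0 \<in> A}"

text \<open>Almost sure convergence in the metric space with carrier \<open>S\<close> and metric \<open>\<rho>\<close>; it includes
  the requirement that all objects involved are elements of \<open>S\<close>.\<close>

definition as_tendsto_in ::
  "'w measure \<Rightarrow> 's set \<Rightarrow> ('s \<Rightarrow> 's \<Rightarrow> real) \<Rightarrow> (nat \<Rightarrow> 'w \<Rightarrow> 's) \<Rightarrow> 's \<Rightarrow> bool" where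
  "as_tendsto_in M S \<rho> X x \<longleftrightarrow>
     (\<forall>n. \<forall>\<omega>\<in>space M. X n \<omega> \<in> S) \<and> x \<in> S \<and>
     (AE \<omega> in M. (\<lambda>n. \<rho> (X n \<omega>) x) \<longlonglongrightarrow> 0)"

definition random_walk :: "(nat \<Rightarrow> 'w \<Rightarrow> 'a::real_normed_vector) \<Rightarrow> nat \<Rightarrow> 'w \<Rightarrow> 'a" where
  "random_walk \<xi> n \<omega> = (\<Sum>i=1..n. \<xi> i \<omega>)"

text \<open>At \<open>n = 0\<close> the factor \<open>inverse 0\<close> is \<open>0\<close>, so the scaled hull is \<open>{0}\<close>.\<close>

definition scaled_walk_hull ::
  "(nat \<Rightarrow> 'w \<Rightarrow> 'a::real_normed_vector) \<Rightarrow> nat \<Rightarrow> 'w \<Rightarrow> 'a set" where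
  "scaled_walk_hull \<xi> n \<omega> =
     (\<lambda>x. inverse (real n) *\<^sub>R x) ` (convex hull {random_walk \<xi> k \<omega> |k. k \<le> n})"

definition drift_segment :: "'a::real_normed_vector \<Rightarrow> 'a set" where
  "drift_segment \<mu> = {t *\<^sub>R \<mu> |t. t \<in> {0..1}}"

end

theory Submission
  imports Defs
begin

text \<open>
  The theorem combines the strong law of large numbers with a deterministic estimate. Convex sets
  have convex \<open>\<epsilon>\<close>-neighbourhoods, so the Hausdorff distance between the scaled hull and the segment
  is at most the largest deviation \<open>\<parallel>S\<^sub>k - k\<mu>\<parallel> / n\<close> with \<open>k \<le> n\<close>, and this tends to \<open>0\<close> wherever
  \<open>S\<^sub>n / n\<close> tends to \<open>\<mu>\<close>.

  The strong law follows Etemadi: along \<open>k\<^sub>j = \<lceil>a\<^sup>j\<rceil>\<close> with \<open>a > 1\<close>, all the first \<open>k\<^sub>j\<close> variables are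
  truncated at the common level \<open>a\<^sup>j\<close>. The truncation errors and the Chebyshev bounds are both summable
  in \<open>j\<close> because, pointwise, each is a geometric sum dominated by a multiple of the variable itself;
  Borel-Cantelli then gives convergence along \<open>k\<^sub>j\<close>. For nonnegative variables monotonicity of the
  partial sums fills the gaps up to a factor \<open>a\<close>, which is arbitrarily close to \<open>1\<close>.
\<close>

subsection \<open>Geometric sums and interpolation\<close>

text \<open>The nonzero terms form an initial segment of a geometric sum, and a geometric sum is at
  most \<open>a / (a - 1)\<close> times its last term, here a power below \<open>x\<close>. So the
  induction looks only at the top index: either it is active and the whole geometric sum is compared
  with it, or it contributes nothing. Applied to \<open>\<bar>X0\<bar>\<close>, this controls the
  tail probabilities.\<close>

lemma sum_powers_below:
  fixes a x :: real
  assumes a: "a > 1" and x: "x \<ge> 0"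
  shows "(\<Sum>j<N. a ^ j * of_bool (a ^ j < x)) \<le> a / (a - 1) * x"
proof (induction N)
  case 0
  then show ?case using a x by simp
next
  case (Suc N)
  show ?case
  proof (cases "a ^ N < x")
    case True
    have "(\<Sum>j<Suc N. a ^ j * of_bool (a ^ j < x)) \<le> (\<Sum>j<Suc N. a ^ j)"
      using a by (intro sum_mono) auto
    also have "\<dots> = (a ^ Suc N - 1) / (a - 1)"
      using a by (subst geometric_sum) auto
    also have "\<dots> \<le> a * a ^ N / (a - 1)"
      using a by (intro divide_right_mono) auto
    also have "\<dots> \<le> a * x / (a - 1)"
      using a True by (intro divide_right_mono mult_left_mono) auto
    also have "\<dots> = a / (a - 1) * x" by simp
    finally show ?thesis .
  qed (use Suc in simp)
qed

text \<open>The nonzero terms form a geometric tail whose first term is at most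
  \<open>1 / x\<close>. The induction peels off the index 0: it vanishes if \<open>x > 1\<close>,
  and then passing to \<open>x / a\<close> shifts the remaining indices down by one, which is why
  \<open>x\<close> has to vary.\<close>

lemma sum_inverse_powers_above:
  fixes a x :: real
  assumes a: "a > 1" and x: "x \<ge> 0"
  shows "x * (\<Sum>j<N. of_bool (x \<le> a ^ j) / a ^ j) \<le> a / (a - 1)"
  using x
proof (induction N arbitrary: x)
  case 0
  then show ?case using a by simp
next
  case (Suc N)
  show ?case
  proof (cases "x \<le> 1")
    case True
    have "x * (\<Sum>j<Suc N. of_bool (x \<le> a ^ j) / a ^ j) \<le> 1 * (\<Sum>j<Suc N. (1 / a) ^ j)"
      using a True Suc.prems
      by (intro mult_mono sum_mono) (auto simp: power_divide sum_nonneg)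
    also have "\<dots> = ((1 / a) ^ Suc N - 1) / (1 / a - 1)"
      using a by (subst geometric_sum) auto
    also have "\<dots> = (1 - (1 / a) ^ Suc N) / (1 - 1 / a)"
      using a by (simp add: field_simps)
    also have "\<dots> \<le> 1 / (1 - 1 / a)"
      using a by (intro divide_right_mono) (auto simp: field_simps)
    also have "\<dots> = a / (a - 1)"
      using a by (simp add: field_simps)
    finally show ?thesis .
  next
    case False
    have "x * (\<Sum>j<Suc N. of_bool (x \<le> a ^ j) / a ^ j) =
        x * (\<Sum>j<N. of_bool (x \<le> a ^ Suc j) / a ^ Suc j)"
      using False by (subst sum.lessThan_Suc_shift) simp
    also have "\<dots> = (x / a) * (\<Sum>j<N. of_bool (x / a \<le> a ^ j) / a ^ j)"
      unfolding sum_distrib_left using a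
      by (intro sum.cong refl) (auto simp: field_simps)
    also have "\<dots> \<le> a / (a - 1)"
      using Suc.prems a by (intro Suc.IH) auto
    finally show ?thesis .
  qed
qed

text \<open>Between consecutive powers of \<open>a\<close>, monotonicity loses at most a factor
  \<open>a\<close> in either direction. The set \<open>A\<close> holds ratios arbitrarily close to
  1, so the loss can be made negligible; allowing a set instead of all \<open>a > 1\<close> lets a
  countable family suffice.\<close>

lemma tendsto_divide_powers_imp_tendsto_divide_index:
  fixes s :: "nat \<Rightarrow> real"
  assumes mono: "mono s" and nonneg: "\<And>n. s n \<ge> 0"
    and lim: "\<And>a. a \<in> A \<Longrightarrow> (\<lambda>j. s (nat \<lceil>a ^ j\<rceil>) / a ^ j) \<longlonglongrightarrow> m"
    and A: "\<And>e. e > 1 \<Longrightarrow> \<exists>a\<in>A. 1 < a \<and> a < e"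
  shows "(\<lambda>n. s n / real n) \<longlonglongrightarrow> m"
proof -
  have m0: "m \<ge> 0"
  proof -
    obtain a where a: "a \<in> A" "1 < a" using A[of 2] by auto
    show ?thesis
      using a nonneg by (intro LIMSEQ_le_const[OF lim[OF a(1)]]) auto
  qed
  \<comment> \<open>For \<open>a^j <= n < a^(j+1)\<close>, the quotient at \<open>n\<close> lies
    between \<open>?q j / a\<close> and \<open>a * ?q (Suc j)\<close>, whose limits are
    \<open>m / a\<close> and \<open>a * m\<close>.\<close>
  have sandwich: "\<forall>\<^sub>F n in sequentially. l < s n / real n \<and> s n / real n < u"
    if a: "a \<in> A" "1 < a" and u: "a * m < u" and l: "l < m / a" for a u l
  proof -
    let ?q = "\<lambda>j. s (nat \<lceil>a ^ j\<rceil>) / a ^ j"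
    have "(\<lambda>j. a * ?q (Suc j)) \<longlonglongrightarrow> a * m" "(\<lambda>j. ?q j / a) \<longlonglongrightarrow> m / a"
      using tendsto_mult_left[OF LIMSEQ_Suc[OF lim[OF a(1)]], of a]
        tendsto_divide[OF lim[OF a(1)] tendsto_const[of a]] a(2) by simp_all
    from order_tendstoD(2)[OF this(1) u] order_tendstoD(1)[OF this(2) l]
    have "\<forall>\<^sub>F j in sequentially. a * ?q (Suc j) < u \<and> l < ?q j / a"
      by (rule eventually_conj)
    then obtain J where J: "\<And>j. j \<ge> J \<Longrightarrow> a * ?q (Suc j) < u \<and> l < ?q j / a"
      unfolding eventually_sequentially by blast
    have "\<forall>\<^sub>F n in sequentially. a ^ J \<le> real n"
      by (rule filterlim_real_sequentially[unfolded filterlim_at_top, rule_format])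
    then show ?thesis
    proof eventually_elim
      case (elim n)
      have "0 < a ^ J" using a by simp
      then have n: "real n > 0" using elim by linarith
      obtain N where N: "real n < a ^ N" using real_arch_pow[OF a(2)] by blast
      \<comment> \<open>The first exponent whose power exceeds \<open>n\<close>; its predecessor
        \<open>j\<close> gives the last power not exceeding \<open>n\<close>. The predecessor exists
        and satisfies \<open>J <= j\<close> because \<open>a ^ J <= n\<close>.\<close>
      define k where "k = (LEAST k. real n < a ^ k)"
      have k: "real n < a ^ k" unfolding k_def by (rule LeastI[of "\<lambda>k. real n < a ^ k", OF N])
      have "J < k"
        by (rule power_less_imp_less_exp[OF a(2)]) (use k elim in linarith)
      then obtain j where j: "k = Suc j" "J \<le> j" by (cases k) auto
      have jn: "a ^ j \<le> real n"
        using not_less_Least[of j "\<lambda>k. real n < a ^ k"] j(1) unfolding k_def[symmetric]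
        by (simp add: not_less)
      have "s n \<le> s (nat \<lceil>a ^ Suc j\<rceil>)"
        using k unfolding j(1) by (intro monoD[OF mono]) linarith
      then have "s n / real n \<le> s (nat \<lceil>a ^ Suc j\<rceil>) / a ^ j"
        using jn a nonneg by (intro frac_le) auto
      also have "\<dots> = a * ?q (Suc j)" using a by simp
      also have "\<dots> < u" using J[OF j(2)] by simp
      finally have upper: "s n / real n < u" .
      have "s (nat \<lceil>a ^ j\<rceil>) \<le> s n"
        using jn by (intro monoD[OF mono]) linarith
      then have "s (nat \<lceil>a ^ j\<rceil>) / a ^ Suc j \<le> s n / real n"
        using k j n a nonneg by (intro frac_le) auto
      moreover have "l < s (nat \<lceil>a ^ j\<rceil>) / a ^ Suc j" using J[OF j(2)] by (simp add: mult.commute)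
      ultimately show ?case using upper by simp
    qed
  qed
  show ?thesis
  proof (rule order_tendstoI)
    fix l assume l: "l < m"
    \<comment> \<open>For positive \<open>l\<close>, the condition \<open>l < m / a\<close> means
      \<open>a < m / l\<close>, and \<open>m / l > 1\<close>. For \<open>l <= 0\<close> every ratio
      works, since \<open>m\<close> is nonnegative.\<close>
    have "\<exists>a\<in>A. 1 < a \<and> l < m / a"
    proof (cases "l > 0")
      case True
      then show ?thesis using A[of "m / l"] l by (auto simp: field_simps)
    next
      case False
      obtain a where "a \<in> A" "1 < a" using A[of 2] by auto
      moreover have "l < m / a"
      proof (cases "m = 0")
        case False
        then have "0 < m / a" using m0 \<open>1 < a\<close> by simp
        then show ?thesis using \<open>\<not> l > 0\<close> by linarith
      qed (use l in simp)
      ultimately show ?thesis by blast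
    qed
    then obtain a where a: "a \<in> A" "1 < a" "l < m / a" by blast
    show "\<forall>\<^sub>F n in sequentially. l < s n / real n"
      \<comment> \<open>Only the lower bound matters here; \<open>a * m + 1\<close> is an arbitrary
        admissible upper bound.\<close>
      using sandwich[OF a(1,2) _ a(3), of "a * m + 1"] by (auto elim: eventually_mono)
  next
    fix u assume u: "m < u"
    have "\<exists>a\<in>A. 1 < a \<and> a * m < u"
    proof (cases "m = 0")
      case True
      then show ?thesis using A[of 2] u by auto
    next
      case False
      then show ?thesis using A[of "u / m"] u m0 by (auto simp: field_simps)
    qed
    then obtain a where a: "a \<in> A" "1 < a" "a * m < u" by blast
    show "\<forall>\<^sub>F n in sequentially. s n / real n < u"
      using sandwich[OF a, of "m / a - 1"] by (auto elim: eventually_mono)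
  qed
qed

subsection \<open>Hausdorff distance of the scaled hull\<close>

text \<open>Nonnegativity is read off from a single term of the first supremum, which is legitimate
  because \<open>e\<close> bounds that family above. Both bounds together turn a small
  \<open>e\<close> into convergence to 0.\<close>

lemma hausdorff_dist_bounds:
  fixes A B :: "'a::real_normed_vector set"
  assumes "A \<noteq> {}" "B \<noteq> {}"
    and AB: "\<And>x. x \<in> A \<Longrightarrow> \<exists>y\<in>B. norm (x - y) \<le> e"
    and BA: "\<And>y. y \<in> B \<Longrightarrow> \<exists>x\<in>A. norm (x - y) \<le> e"
  shows "0 \<le> hausdorff_dist A B" "hausdorff_dist A B \<le> e"
proof -
  have bdd: "bdd_below ((\<lambda>y. norm (f y)) ` C)" for f :: "'a \<Rightarrow> 'a" and C
    by (rule bdd_belowI[of _ 0]) auto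
  have A: "0 \<le> (INF y\<in>B. norm (x - y))" "(INF y\<in>B. norm (x - y)) \<le> e" if x: "x \<in> A" for x
  proof -
    show "0 \<le> (INF y\<in>B. norm (x - y))" using assms by (intro cINF_greatest) auto
    obtain y where "y \<in> B" "norm (x - y) \<le> e" using AB[OF x] by blast
    then show "(INF y\<in>B. norm (x - y)) \<le> e" by (intro cINF_lower2[OF bdd]) auto
  qed
  have B: "(INF x\<in>A. norm (x - y)) \<le> e" if y: "y \<in> B" for y
  proof -
    obtain x where "x \<in> A" "norm (x - y) \<le> e" using BA[OF y] by blast
    then show ?thesis by (intro cINF_lower2[OF bdd]) auto
  qed
  obtain x where x: "x \<in> A" using assms by blast
  have "bdd_above ((\<lambda>x. INF y\<in>B. norm (x - y)) ` A)"
    using A(2) by (intro bdd_aboveI[of _ e]) auto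
  from cSUP_upper[OF x this] A(1)[OF x] show "0 \<le> hausdorff_dist A B"
    unfolding hausdorff_dist_def by linarith
  show "hausdorff_dist A B \<le> e"
    unfolding hausdorff_dist_def using assms(1,2) A(2) B by (auto intro!: cSUP_least)
qed

text \<open>The neighbourhood \<open>B + cball 0 e\<close> is a Minkowski sum of convex sets, hence
  convex, so containing \<open>A\<close> it contains the hull of \<open>A\<close>.\<close>

lemma convex_hull_within:
  fixes A B :: "'a::real_normed_vector set"
  assumes B: "convex B" and AB: "\<And>x. x \<in> A \<Longrightarrow> \<exists>y\<in>B. norm (x - y) \<le> e"
    and x: "x \<in> convex hull A"
  shows "\<exists>y\<in>B. norm (x - y) \<le> e"
proof -
  have "A \<subseteq> B + cball 0 e"
  proof
    fix x assume "x \<in> A"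
    then obtain y where "y \<in> B" "norm (x - y) \<le> e" using AB by blast
    then have "y + (x - y) \<in> B + cball 0 e" by (intro set_plus_intro) auto
    then show "x \<in> B + cball 0 e" by simp
  qed
  then have "convex hull A \<subseteq> B + cball 0 e"
    by (intro hull_minimal convex_set_plus B convex_cball)
  then obtain y z where "y \<in> B" "norm z \<le> e" "x = y + z"
    using x by (auto elim!: set_plus_elim)
  then show ?thesis by (intro bexI[of _ y]) auto
qed

lemma drift_segment_eq: "drift_segment \<mu> = closed_segment 0 \<mu>"
  by (auto simp: drift_segment_def closed_segment_def)

lemma scaled_walk_hull_eq:
  "scaled_walk_hull \<xi> n \<omega> =
     convex hull ((\<lambda>k. inverse (real n) *\<^sub>R random_walk \<xi> k \<omega>) ` {..n})"
proof -
  have "{random_walk \<xi> k \<omega> |k. k \<le> n} = (\<lambda>k. random_walk \<xi> k \<omega>) ` {..n}" by auto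
  then show ?thesis
    unfolding scaled_walk_hull_def by (simp only: convex_hull_scaling[symmetric] image_image)
qed

lemma scaled_walk_hull_in_convex_compact0: "scaled_walk_hull \<xi> n \<omega> \<in> convex_compact0"
proof -
  \<comment> \<open>The origin is the empty sum at \<open>k = 0\<close>; this covers
    \<open>n = 0\<close> as well.\<close>
  have "0 \<in> (\<lambda>k. inverse (real n) *\<^sub>R random_walk \<xi> k \<omega>) ` {..n}"
    by (auto simp: random_walk_def image_iff intro!: bexI[of _ 0])
  then show ?thesis
    unfolding convex_compact0_def scaled_walk_hull_eq
    by (auto intro!: finite_imp_compact_convex_hull hull_inc)
qed

lemma drift_segment_in_convex_compact0: "drift_segment \<mu> \<in> convex_compact0"
  by (auto simp: convex_compact0_def drift_segment_eq)

text \<open>By \<open>convex_hull_within\<close> only generators need partners: the scaled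
  \<open>k\<close>-th position is matched with the point of the segment at parameter
  \<open>k / n\<close>, and in the other direction the endpoints 0 and \<open>\<mu>\<close> are
  matched with the scaled positions at times 0 and \<open>n\<close>.\<close>

lemma hausdorff_dist_scaled_walk_hull:
  assumes n: "n \<ge> 1"
    and e: "\<And>k. k \<le> n \<Longrightarrow> norm (random_walk \<xi> k \<omega> - real k *\<^sub>R \<mu>) \<le> e * real n"
  shows "0 \<le> hausdorff_dist (scaled_walk_hull \<xi> n \<omega>) (drift_segment \<mu>)"
    and "hausdorff_dist (scaled_walk_hull \<xi> n \<omega>) (drift_segment \<mu>) \<le> e"
proof -
  let ?S = "\<lambda>k. inverse (real n) *\<^sub>R random_walk \<xi> k \<omega>"
  have dist: "norm (?S k - (real k / real n) *\<^sub>R \<mu>) \<le> e" if "k \<le> n" for k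
  proof -
    have "?S k - (real k / real n) *\<^sub>R \<mu> = inverse (real n) *\<^sub>R (random_walk \<xi> k \<omega> - real k *\<^sub>R \<mu>)"
      by (simp add: scaleR_diff_right divide_inverse mult.commute)
    then have "norm (?S k - (real k / real n) *\<^sub>R \<mu>) =
        norm (random_walk \<xi> k \<omega> - real k *\<^sub>R \<mu>) / real n"
      by (simp add: divide_inverse mult.commute)
    also have "\<dots> \<le> e" using e[OF that] n by (simp add: field_simps)
    finally show ?thesis .
  qed
  have wd: "\<exists>y\<in>drift_segment \<mu>. norm (x - y) \<le> e" if "x \<in> scaled_walk_hull \<xi> n \<omega>" for x
  proof (rule convex_hull_within[OF _ _ that[unfolded scaled_walk_hull_eq]])
    fix x assume "x \<in> ?S ` {..n}"
    then obtain k where "k \<le> n" "x = ?S k" by auto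
    then show "\<exists>y\<in>drift_segment \<mu>. norm (x - y) \<le> e"
      using dist[of k] n
      by (intro bexI[of _ "(real k / real n) *\<^sub>R \<mu>"]) (auto simp: drift_segment_def)
  qed (auto simp: drift_segment_eq)
  have dw: "\<exists>x\<in>scaled_walk_hull \<xi> n \<omega>. norm (x - y) \<le> e" if y: "y \<in> drift_segment \<mu>" for y
  proof -
    have "y \<in> convex hull {0, \<mu>}" using y by (simp add: drift_segment_eq segment_convex_hull)
    then have "\<exists>x\<in>scaled_walk_hull \<xi> n \<omega>. norm (y - x) \<le> e"
    proof (rule convex_hull_within[rotated 2])
      have in_hull: "?S k \<in> scaled_walk_hull \<xi> n \<omega>" if "k \<le> n" for k
        using that by (auto simp: scaled_walk_hull_eq intro!: hull_inc)
      fix z assume "z \<in> {0, \<mu>}"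
      then consider "z = 0" | "z = \<mu>" by blast
      then show "\<exists>x\<in>scaled_walk_hull \<xi> n \<omega>. norm (z - x) \<le> e"
      proof cases
        case 1
        then show ?thesis using dist[of 0] by (intro bexI[OF _ in_hull[of 0]]) auto
      next
        case 2
        then show ?thesis
          using dist[of n] n by (intro bexI[OF _ in_hull[of n]]) (auto simp: norm_minus_commute)
      qed
    qed (simp add: scaled_walk_hull_eq)
    then show ?thesis by (simp add: norm_minus_commute)
  qed
  have "scaled_walk_hull \<xi> n \<omega> \<noteq> {}" "drift_segment \<mu> \<noteq> {}"
    by (auto simp: scaled_walk_hull_eq drift_segment_eq)
  from hausdorff_dist_bounds[OF this wd dw]
  show "0 \<le> hausdorff_dist (scaled_walk_hull \<xi> n \<omega>) (drift_segment \<mu>)"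
    and "hausdorff_dist (scaled_walk_hull \<xi> n \<omega>) (drift_segment \<mu>) \<le> e" by blast+
qed

text \<open>The maximal deviation up to time \<open>n\<close> is \<open>o(n)\<close>: late times
  \<open>k\<close> deviate by at most a small multiple of \<open>k <= n\<close>, and the finitely
  many early ones by a constant that \<open>n\<close> eventually absorbs.\<close>

lemma hausdorff_dist_scaled_walk_hull_tendsto:
  assumes lim: "(\<lambda>n. random_walk \<xi> n \<omega> /\<^sub>R real n) \<longlonglongrightarrow> \<mu>"
  shows "(\<lambda>n. hausdorff_dist (scaled_walk_hull \<xi> n \<omega>) (drift_segment \<mu>)) \<longlonglongrightarrow> 0"
proof (rule LIMSEQ_I)
  fix r :: real assume r: "r > 0"
  define D where "D k = norm (random_walk \<xi> k \<omega> - real k *\<^sub>R \<mu>)" for k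
  obtain K where K: "\<And>k. k \<ge> K \<Longrightarrow> norm (random_walk \<xi> k \<omega> /\<^sub>R real k - \<mu>) < r / 2"
    using LIMSEQ_D[OF lim, of "r / 2"] r by auto
  have tail: "D k \<le> r / 2 * real k" if k: "k \<ge> K" "k \<ge> 1" for k
  proof -
    have "random_walk \<xi> k \<omega> - real k *\<^sub>R \<mu> = real k *\<^sub>R (random_walk \<xi> k \<omega> /\<^sub>R real k - \<mu>)"
      using k by (simp add: scaleR_diff_right)
    then have "D k = real k * norm (random_walk \<xi> k \<omega> /\<^sub>R real k - \<mu>)"
      unfolding D_def by simp
    also have "\<dots> \<le> real k * (r / 2)" using K[OF k(1)] by (intro mult_left_mono) auto
    finally show ?thesis by (simp add: mult.commute)
  qed
  \<comment> \<open>The sum is a crude bound for the maximum of the nonnegative early deviations.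
    The range reaches \<open>K\<close>, so every remaining time is at least 1 and
    \<open>tail\<close> applies.\<close>
  define C where "C = (\<Sum>k<Suc K. D k)"
  obtain N where N: "C \<le> r / 2 * real N"
    using r real_arch_simple[of "C / (r / 2)"] by (auto simp: field_simps)
  show "\<exists>no. \<forall>n\<ge>no. norm (hausdorff_dist (scaled_walk_hull \<xi> n \<omega>) (drift_segment \<mu>) - 0) < r"
  proof (intro exI allI impI)
    \<comment> \<open>The successor guarantees \<open>n >= 1\<close>, so division by
      \<open>n\<close> is genuine.\<close>
    fix n assume n: "n \<ge> Suc N"
    have "D k \<le> r / 2 * real n" if "k \<le> n" for k
    proof (cases "k < Suc K")
      case True
      then have "D k \<le> C" unfolding C_def by (intro member_le_sum) (auto simp: D_def)
      also have "\<dots> \<le> r / 2 * real n" using n r by (intro order_trans[OF N] mult_left_mono) auto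
      finally show ?thesis .
    next
      case False
      then have "D k \<le> r / 2 * real k" by (intro tail) auto
      also have "\<dots> \<le> r / 2 * real n" using that r by (intro mult_left_mono) auto
      finally show ?thesis .
    qed
    from hausdorff_dist_scaled_walk_hull[OF _ this[unfolded D_def]] n r
    show "norm (hausdorff_dist (scaled_walk_hull \<xi> n \<omega>) (drift_segment \<mu>) - 0) < r"
      by fastforce
  qed
qed

subsection \<open>Strong law of large numbers\<close>

text \<open>Additivity of variances for centred variables: a new summand is independent of the sum
  of the others, so the mixed term has expectation 0. Integrability is carried along because the
  next induction step needs it for that product.\<close>

lemma (in prob_space) second_moment_sum_indep:
  fixes Z :: "'i \<Rightarrow> 'a \<Rightarrow> real"
  assumes "finite I" "indep_vars (\<lambda>_. borel) Z I"
    and "\<And>i. i \<in> I \<Longrightarrow> integrable M (\<lambda>\<omega>. (Z i \<omega>)\<^sup>2)"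
    and "\<And>i. i \<in> I \<Longrightarrow> expectation (Z i) = 0"
  shows "integrable M (\<lambda>\<omega>. (\<Sum>i\<in>I. Z i \<omega>)\<^sup>2) \<and>
    expectation (\<lambda>\<omega>. (\<Sum>i\<in>I. Z i \<omega>)\<^sup>2) = (\<Sum>i\<in>I. expectation (\<lambda>\<omega>. (Z i \<omega>)\<^sup>2))"
  using assms
proof (induction I rule: finite_induct)
  case empty
  then show ?case by simp
next
  case (insert x F)
  have meas: "random_variable borel (Z i)" if "i \<in> insert x F" for i
    using insert.prems(1) that unfolding indep_vars_def by blast
  let ?T = "\<lambda>\<omega>. \<Sum>i\<in>F. Z i \<omega>"
  have IH: "integrable M (\<lambda>\<omega>. (?T \<omega>)\<^sup>2)"
    "expectation (\<lambda>\<omega>. (?T \<omega>)\<^sup>2) = (\<Sum>i\<in>F. expectation (\<lambda>\<omega>. (Z i \<omega>)\<^sup>2))"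
    using insert.IH insert.prems indep_vars_subset[OF insert.prems(1), of F] by auto
  have indep: "indep_var borel (Z x) borel ?T"
    by (rule indep_vars_sum[OF insert.hyps insert.prems(1)])
  have T: "random_variable borel ?T" by (intro borel_measurable_sum meas) simp
  note int = square_integrable_imp_integrable[OF meas[OF insertI1] insert.prems(2)[OF insertI1]]
    square_integrable_imp_integrable[OF T IH(1)]
  have eq: "(\<lambda>\<omega>. (\<Sum>i\<in>insert x F. Z i \<omega>)\<^sup>2) =
      (\<lambda>\<omega>. (Z x \<omega>)\<^sup>2 + 2 * (Z x \<omega> * ?T \<omega>) + (?T \<omega>)\<^sup>2)"
    using insert.hyps by (auto simp: power2_sum)
  note prod = indep_var_integrable[OF indep int] indep_var_lebesgue_integral[OF indep int]
  show ?case
    unfolding eq using prod IH insert.hyps insert.prems(2,3) by simp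
qed

lemma (in prob_space) integrable_iff_of_distr_eq:
  fixes h :: "'b::topological_space \<Rightarrow> 'c::{banach, second_countable_topology}"
  assumes "distr M borel X = distr M borel Y" "random_variable borel X" "random_variable borel Y"
    and "h \<in> borel_measurable borel"
  shows "integrable M (\<lambda>\<omega>. h (X \<omega>)) \<longleftrightarrow> integrable M (\<lambda>\<omega>. h (Y \<omega>))"
  using integrable_distr_eq[OF assms(2,4)] integrable_distr_eq[OF assms(3,4)] assms(1) by simp

lemma (in prob_space) expectation_eq_of_distr_eq:
  fixes h :: "'b::topological_space \<Rightarrow> 'c::{banach, second_countable_topology}"
  assumes "distr M borel X = distr M borel Y" "random_variable borel X" "random_variable borel Y"
    and "h \<in> borel_measurable borel"
  shows "expectation (\<lambda>\<omega>. h (X \<omega>)) = expectation (\<lambda>\<omega>. h (Y \<omega>))"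
  using integral_distr[OF assms(2,4)] integral_distr[OF assms(3,4)] assms(1) by simp

text \<open>Truncate all \<open>n\<close> variables at the level \<open>t\<close>. Either some
  variable exceeds \<open>t\<close> in modulus, which the union bound controls by the first term, or
  truncation changes nothing and Chebyshev's inequality for the truncated sum gives the second. The
  centring is accordingly at the truncated mean.\<close>

lemma (in prob_space) prob_iid_sum_deviation_le:
  fixes X :: "nat \<Rightarrow> 'a \<Rightarrow> real" and X0 :: "'a \<Rightarrow> real" and t :: real
  assumes indep: "indep_vars (\<lambda>_. borel) X {1..}"
    and X0 [measurable]: "random_variable borel X0"
    and distr: "\<And>i. i \<ge> 1 \<Longrightarrow> distr M borel (X i) = distr M borel X0"
    and e: "e > 0" and n: "n \<ge> 1"
  defines "g \<equiv> \<lambda>x. x * of_bool (\<bar>x\<bar> \<le> t)"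
  shows "prob {\<omega>\<in>space M. e * real n \<le> \<bar>(\<Sum>i=1..n. X i \<omega>) - real n * expectation (\<lambda>\<omega>. g (X0 \<omega>))\<bar>}
    \<le> real n * expectation (\<lambda>\<omega>. of_bool (t < \<bar>X0 \<omega>\<bar>)) +
      expectation (\<lambda>\<omega>. (g (X0 \<omega>))\<^sup>2) / (real n * e\<^sup>2)"
proof -
  have X [measurable]: "random_variable borel (X i)" if "i \<in> {1..n}" for i
    using indep that unfolding indep_vars_def by auto
  have g [measurable]: "g \<in> borel_measurable borel"
    unfolding g_def of_bool_def by measurable
  define m where "m = expectation (\<lambda>\<omega>. g (X0 \<omega>))"
  define Z where "Z i \<omega> = g (X i \<omega>) - m" for i \<omega>
  have g_bound: "\<bar>g x\<bar> \<le> \<bar>t\<bar>" for x by (auto simp: g_def)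
  have int_g: "integrable M (\<lambda>\<omega>. g (X0 \<omega>))"
    using g_bound by (intro integrable_const_bound[of _ "\<bar>t\<bar>"]) auto
  have int_g2: "integrable M (\<lambda>\<omega>. (g (X0 \<omega>))\<^sup>2)"
    using g_bound[unfolded abs_le_square_iff] by (intro integrable_const_bound[of _ "t\<^sup>2"]) auto
  have same: "expectation (\<lambda>\<omega>. h (X i \<omega>)) = expectation (\<lambda>\<omega>. h (X0 \<omega>))"
    "integrable M (\<lambda>\<omega>. h (X i \<omega>)) \<longleftrightarrow> integrable M (\<lambda>\<omega>. h (X0 \<omega>))"
    if "i \<in> {1..n}" "h \<in> borel_measurable borel" for h :: "real \<Rightarrow> real" and i
    using that expectation_eq_of_distr_eq[OF distr X X0, of i h]
      integrable_iff_of_distr_eq[OF distr X X0, of i h] by auto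
  have Z_exp: "expectation (Z i) = 0" if "i \<in> {1..n}" for i
    using same[OF that, of "\<lambda>x. g x"] int_g prob_space by (simp add: Z_def[abs_def] m_def)
  have Z_sq: "integrable M (\<lambda>\<omega>. (Z i \<omega>)\<^sup>2)"
    "expectation (\<lambda>\<omega>. (Z i \<omega>)\<^sup>2) \<le> expectation (\<lambda>\<omega>. (g (X0 \<omega>))\<^sup>2)" if i: "i \<in> {1..n}" for i
  proof -
    have "integrable M (\<lambda>\<omega>. (g (X0 \<omega>) - m)\<^sup>2)"
      unfolding power2_diff using int_g int_g2 by auto
    \<comment> \<open>A variance is at most the second moment.\<close>
    moreover have "expectation (\<lambda>\<omega>. (g (X0 \<omega>) - m)\<^sup>2) \<le> expectation (\<lambda>\<omega>. (g (X0 \<omega>))\<^sup>2)"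
      unfolding m_def by (subst variance_eq) (use int_g int_g2 in auto)
    ultimately show "integrable M (\<lambda>\<omega>. (Z i \<omega>)\<^sup>2)"
      "expectation (\<lambda>\<omega>. (Z i \<omega>)\<^sup>2) \<le> expectation (\<lambda>\<omega>. (g (X0 \<omega>))\<^sup>2)"
      using same[OF i, of "\<lambda>x. (g x - m)\<^sup>2"] by (simp_all add: Z_def)
  qed
  have "indep_vars (\<lambda>_. borel) Z {1..n}"
    unfolding Z_def by (rule indep_vars_compose2[OF indep_vars_subset[OF indep]]) auto
  note Z_sum = second_moment_sum_indep[OF finite_atLeastAtMost this Z_sq(1) Z_exp]
  define T where "T \<omega> = (\<Sum>i=1..n. Z i \<omega>)" for \<omega>
  have T_sq: "integrable M (\<lambda>\<omega>. (T \<omega>)\<^sup>2)"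
    "expectation (\<lambda>\<omega>. (T \<omega>)\<^sup>2) = (\<Sum>i=1..n. expectation (\<lambda>\<omega>. (Z i \<omega>)\<^sup>2))"
    using Z_sum by (simp_all add: T_def)
  have [measurable]: "random_variable borel T"
    unfolding T_def Z_def by measurable
  define A where "A = {\<omega>\<in>space M. e * real n \<le> \<bar>T \<omega>\<bar>}"
  define B where "B i = {\<omega>\<in>space M. t < \<bar>X i \<omega>\<bar>}" for i
  have [measurable]: "A \<in> events" "\<And>i. i \<in> {1..n} \<Longrightarrow> B i \<in> events"
    unfolding A_def B_def by measurable
  have "prob A \<le> expectation (\<lambda>\<omega>. (T \<omega>)\<^sup>2) / (e * real n)\<^sup>2"
    unfolding A_def using T_sq(1) e n by (intro second_moment_method) auto
  also have "expectation (\<lambda>\<omega>. (T \<omega>)\<^sup>2) = (\<Sum>i=1..n. expectation (\<lambda>\<omega>. (Z i \<omega>)\<^sup>2))"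
    by (rule T_sq(2))
  also have "\<dots> \<le> real n * expectation (\<lambda>\<omega>. (g (X0 \<omega>))\<^sup>2)"
    using sum_bounded_above[of "{1..n}" "\<lambda>i. expectation (\<lambda>\<omega>. (Z i \<omega>)\<^sup>2)"] Z_sq(2) by simp
  finally have "prob A \<le> real n * expectation (\<lambda>\<omega>. (g (X0 \<omega>))\<^sup>2) / (e * real n)\<^sup>2"
    by (simp add: divide_right_mono)
  also have "\<dots> = expectation (\<lambda>\<omega>. (g (X0 \<omega>))\<^sup>2) / (real n * e\<^sup>2)"
    using n e by (simp add: power2_eq_square field_simps)
  finally have A: "prob A \<le> expectation (\<lambda>\<omega>. (g (X0 \<omega>))\<^sup>2) / (real n * e\<^sup>2)" .
  have B: "prob (B i) = expectation (\<lambda>\<omega>. of_bool (t < \<bar>X0 \<omega>\<bar>))" if i: "i \<in> {1..n}" for i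
  proof -
    have "prob (B i) = expectation (indicator (B i))"
      using i by simp
    also have "\<dots> = expectation (\<lambda>\<omega>. of_bool (t < \<bar>X i \<omega>\<bar>))"
      by (intro Bochner_Integration.integral_cong) (auto simp: B_def indicator_def)
    also have "\<dots> = expectation (\<lambda>\<omega>. of_bool (t < \<bar>X0 \<omega>\<bar>))"
      by (rule same[OF i]) (simp add: of_bool_def)
    finally show ?thesis .
  qed
  have "{\<omega>\<in>space M. e * real n \<le> \<bar>(\<Sum>i=1..n. X i \<omega>) - real n * m\<bar>} \<subseteq> A \<union> (\<Union>i\<in>{1..n}. B i)"
  proof
    fix \<omega> assume \<omega>: "\<omega> \<in> {\<omega>\<in>space M. e * real n \<le> \<bar>(\<Sum>i=1..n. X i \<omega>) - real n * m\<bar>}"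
    show "\<omega> \<in> A \<union> (\<Union>i\<in>{1..n}. B i)"
    proof (cases "\<exists>i\<in>{1..n}. \<omega> \<in> B i")
      case False
      then have "g (X i \<omega>) = X i \<omega>" if "i \<in> {1..n}" for i
        using that \<omega> by (force simp: B_def g_def)
      then have "T \<omega> = (\<Sum>i=1..n. X i \<omega>) - real n * m"
        by (simp add: T_def Z_def sum_subtractf)
      then show ?thesis using \<omega> by (simp add: A_def)
    qed auto
  qed
  then have "prob {\<omega>\<in>space M. e * real n \<le> \<bar>(\<Sum>i=1..n. X i \<omega>) - real n * m\<bar>} \<le>
      prob (A \<union> (\<Union>i\<in>{1..n}. B i))"
    by (intro finite_measure_mono) measurable
  also have "\<dots> \<le> prob A + prob (\<Union>i\<in>{1..n}. B i)"
    by (intro measure_Un_le) measurable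
  also have "prob (\<Union>i\<in>{1..n}. B i) \<le> (\<Sum>i=1..n. prob (B i))"
    by (intro finite_measure_subadditive_finite) auto
  also have "\<dots> = real n * expectation (\<lambda>\<omega>. of_bool (t < \<bar>X0 \<omega>\<bar>))"
    using B by simp
  finally show ?thesis using A unfolding m_def by linarith
qed

text \<open>Exchanging finite sum and expectation reduces both claims to pointwise bounds by
  \<open>?C * \<bar>X0 \<omega>\<bar>\<close>, so the partial sums stay below a multiple of the
  first absolute moment.\<close>

lemma (in prob_space) summable_truncation_bounds:
  fixes X0 :: "'a \<Rightarrow> real"
  assumes int: "integrable M X0" and a: "a > 1"
  shows "summable (\<lambda>j. a ^ j * expectation (\<lambda>\<omega>. of_bool (a ^ j < \<bar>X0 \<omega>\<bar>)))"
    and "summable (\<lambda>j. expectation (\<lambda>\<omega>. (X0 \<omega> * of_bool (\<bar>X0 \<omega>\<bar> \<le> a ^ j))\<^sup>2) / a ^ j)"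
proof -
  note [measurable] = borel_measurable_integrable[OF int]
  let ?C = "a / (a - 1)"
  have int1: "integrable M (\<lambda>\<omega>. of_bool (a ^ j < \<bar>X0 \<omega>\<bar>) :: real)" for j
    by (intro integrable_const_bound[of _ 1]) (auto simp: of_bool_def)
  have int2: "integrable M (\<lambda>\<omega>. (X0 \<omega> * of_bool (\<bar>X0 \<omega>\<bar> \<le> a ^ j))\<^sup>2)" for j
    by (intro integrable_const_bound[of _ "(a ^ j)\<^sup>2"]) (auto simp: of_bool_def abs_le_square_iff[symmetric])
  show "summable (\<lambda>j. a ^ j * expectation (\<lambda>\<omega>. of_bool (a ^ j < \<bar>X0 \<omega>\<bar>)))"
  proof (rule summableI_nonneg_bounded)
    fix N
    have "(\<Sum>j<N. a ^ j * expectation (\<lambda>\<omega>. of_bool (a ^ j < \<bar>X0 \<omega>\<bar>))) =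
        expectation (\<lambda>\<omega>. \<Sum>j<N. a ^ j * of_bool (a ^ j < \<bar>X0 \<omega>\<bar>))"
      using int1 by (subst Bochner_Integration.integral_sum) auto
    also have "\<dots> \<le> expectation (\<lambda>\<omega>. ?C * \<bar>X0 \<omega>\<bar>)"
      by (intro integral_mono Bochner_Integration.integrable_sum integrable_mult_right
          integrable_abs int int1 sum_powers_below a) simp
    finally show "(\<Sum>j<N. a ^ j * expectation (\<lambda>\<omega>. of_bool (a ^ j < \<bar>X0 \<omega>\<bar>))) \<le>
        expectation (\<lambda>\<omega>. ?C * \<bar>X0 \<omega>\<bar>)" .
  qed (use a in \<open>auto intro!: mult_nonneg_nonneg integral_nonneg\<close>)
  show "summable (\<lambda>j. expectation (\<lambda>\<omega>. (X0 \<omega> * of_bool (\<bar>X0 \<omega>\<bar> \<le> a ^ j))\<^sup>2) / a ^ j)"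
  proof (rule summableI_nonneg_bounded)
    fix N
    \<comment> \<open>One factor \<open>\<bar>x\<bar>\<close> of the square is kept; the other is
      absorbed by \<open>sum_inverse_powers_above\<close>.\<close>
    have pointwise: "(\<Sum>j<N. (x * of_bool (\<bar>x\<bar> \<le> a ^ j))\<^sup>2 / a ^ j) \<le> ?C * \<bar>x\<bar>" for x :: real
    proof -
      have "(\<Sum>j<N. (x * of_bool (\<bar>x\<bar> \<le> a ^ j))\<^sup>2 / a ^ j) =
          \<bar>x\<bar> * (\<bar>x\<bar> * (\<Sum>j<N. of_bool (\<bar>x\<bar> \<le> a ^ j) / a ^ j))"
        unfolding sum_distrib_left by (intro sum.cong) (auto simp: power2_eq_square)
      also have "\<dots> \<le> \<bar>x\<bar> * ?C"
        by (intro mult_left_mono sum_inverse_powers_above a) auto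
      finally show ?thesis by (simp add: mult.commute)
    qed
    have "(\<Sum>j<N. expectation (\<lambda>\<omega>. (X0 \<omega> * of_bool (\<bar>X0 \<omega>\<bar> \<le> a ^ j))\<^sup>2) / a ^ j) =
        expectation (\<lambda>\<omega>. \<Sum>j<N. (X0 \<omega> * of_bool (\<bar>X0 \<omega>\<bar> \<le> a ^ j))\<^sup>2 / a ^ j)"
      using int2 by (subst Bochner_Integration.integral_sum) auto
    also have "\<dots> \<le> expectation (\<lambda>\<omega>. ?C * \<bar>X0 \<omega>\<bar>)"
      by (intro integral_mono Bochner_Integration.integrable_sum integrable_divide_zero
          integrable_mult_right integrable_abs int int2 pointwise)
    finally show "(\<Sum>j<N. expectation (\<lambda>\<omega>. (X0 \<omega> * of_bool (\<bar>X0 \<omega>\<bar> \<le> a ^ j))\<^sup>2) / a ^ j) \<le>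
        expectation (\<lambda>\<omega>. ?C * \<bar>X0 \<omega>\<bar>)" .
  qed (use a in \<open>auto intro!: divide_nonneg_pos integral_nonneg\<close>)
qed

lemma (in prob_space) iid_sum_along_powers:
  fixes X :: "nat \<Rightarrow> 'a \<Rightarrow> real" and X0 :: "'a \<Rightarrow> real"
  assumes indep: "indep_vars (\<lambda>_. borel) X {1..}"
    and int: "integrable M X0"
    and distr: "\<And>i. i \<ge> 1 \<Longrightarrow> distr M borel (X i) = distr M borel X0"
    and a: "a > 1"
  shows "AE \<omega> in M. (\<lambda>j. (\<Sum>i=1..nat \<lceil>a ^ j\<rceil>. X i \<omega>) / a ^ j) \<longlonglongrightarrow> expectation X0"
proof -
  note X0 [measurable] = borel_measurable_integrable[OF int]
  have X [measurable]: "random_variable borel (X i)" if "i \<in> {1..}" for i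
    using indep that unfolding indep_vars_def by auto
  define k where "k j = nat \<lceil>a ^ j\<rceil>" for j
  define m where "m j = expectation (\<lambda>\<omega>. X0 \<omega> * of_bool (\<bar>X0 \<omega>\<bar> \<le> a ^ j))" for j
  have pow: "1 \<le> a ^ j" for j using a by simp
  have k: "a ^ j \<le> real (k j)" "real (k j) \<le> a ^ j + 1" "k j \<ge> 1" for j
    unfolding k_def using pow[of j] by linarith+
  have k2: "real (k j) \<le> 2 * a ^ j" for j using k(2)[of j] pow[of j] by linarith
  have pow_inf: "filterlim (\<lambda>j. a ^ j) at_top sequentially"
    using a filterlim_realpow_sequentially_gt1[of a] filterlim_at_infinity_imp_filterlim_at_top[of "\<lambda>j. a ^ j" sequentially]
    by (simp add: always_eventually)
  have k_ratio: "(\<lambda>j. real (k j) / a ^ j) \<longlonglongrightarrow> 1"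
  proof (rule tendsto_sandwich[OF _ _ tendsto_const])
    show "\<forall>\<^sub>F j in sequentially. 1 \<le> real (k j) / a ^ j"
      using k(1) a by (intro always_eventually) (auto simp: field_simps)
    show "\<forall>\<^sub>F j in sequentially. real (k j) / a ^ j \<le> 1 + 1 / a ^ j"
      using k(2) a by (intro always_eventually) (auto simp: field_simps)
    have "(\<lambda>j. 1 / a ^ j) \<longlonglongrightarrow> 0"
      by (intro tendsto_divide_0[OF tendsto_const] filterlim_at_top_imp_at_infinity pow_inf)
    from tendsto_add[OF tendsto_const[of 1] this]
    show "(\<lambda>j. 1 + 1 / a ^ j) \<longlonglongrightarrow> 1" by simp
  qed
  \<comment> \<open>Dominated convergence: at each point the truncation is eventually
    inactive.\<close>
  have m_lim: "m \<longlonglongrightarrow> expectation X0"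
    unfolding m_def
  proof (rule integral_dominated_convergence[where w = "\<lambda>\<omega>. \<bar>X0 \<omega>\<bar>"])
    show "AE \<omega> in M. (\<lambda>j. X0 \<omega> * of_bool (\<bar>X0 \<omega>\<bar> \<le> a ^ j)) \<longlonglongrightarrow> X0 \<omega>"
    proof (rule AE_I2)
      fix \<omega>
      have "\<forall>\<^sub>F j in sequentially. \<bar>X0 \<omega>\<bar> \<le> a ^ j"
        using pow_inf by (simp add: filterlim_at_top)
      then have "\<forall>\<^sub>F j in sequentially. X0 \<omega> * of_bool (\<bar>X0 \<omega>\<bar> \<le> a ^ j) = X0 \<omega>"
        by eventually_elim simp
      then show "(\<lambda>j. X0 \<omega> * of_bool (\<bar>X0 \<omega>\<bar> \<le> a ^ j)) \<longlonglongrightarrow> X0 \<omega>"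
        by (rule tendsto_eventually)
    qed
  qed (use int in \<open>auto simp: of_bool_def\<close>)
  \<comment> \<open>Tolerances \<open>1 / (p + 1)\<close> are used so that the exceptional null sets
    are countably many and can be united.\<close>
  have "AE \<omega> in M. \<forall>\<^sub>F j in sequentially.
      \<bar>(\<Sum>i=1..k j. X i \<omega>) - real (k j) * m j\<bar> < 1 / real (Suc p) * real (k j)" for p
  proof -
    define e where "e = 1 / real (Suc p)"
    have e: "e > 0" by (simp add: e_def)
    define D where "D j = {\<omega>\<in>space M. e * real (k j) \<le> \<bar>(\<Sum>i=1..k j. X i \<omega>) - real (k j) * m j\<bar>}" for j
    have [measurable]: "D j \<in> events" for j
      unfolding D_def by measurable
    let ?p = "\<lambda>j. expectation (\<lambda>\<omega>. of_bool (a ^ j < \<bar>X0 \<omega>\<bar>)) :: real"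
    let ?v = "\<lambda>j. expectation (\<lambda>\<omega>. (X0 \<omega> * of_bool (\<bar>X0 \<omega>\<bar> \<le> a ^ j))\<^sup>2)"
    \<comment> \<open>The comparison \<open>a^j <= k j <= 2 * a^j\<close> replaces
      \<open>k j\<close> by the power in both terms and yields the series shown summable before; the
      factor 2 pays for rounding up.\<close>
    have bound: "prob (D j) \<le> 2 * (a ^ j * ?p j) + ?v j / a ^ j / e\<^sup>2" for j
    proof -
      have "prob (D j) \<le> real (k j) * ?p j + ?v j / (real (k j) * e\<^sup>2)"
        unfolding D_def m_def by (rule prob_iid_sum_deviation_le[OF indep X0 distr e k(3)])
      also have "real (k j) * ?p j \<le> (2 * a ^ j) * ?p j"
        by (intro mult_right_mono k2 integral_nonneg) auto
      also have "?v j / (real (k j) * e\<^sup>2) \<le> ?v j / (a ^ j * e\<^sup>2)"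
        using e a k(1)[of j] k(3)[of j]
        by (intro divide_left_mono mult_right_mono mult_pos_pos integral_nonneg) auto
      finally show ?thesis by simp
    qed
    have "summable (\<lambda>j. prob (D j))"
    proof (rule summable_comparison_test')
      show "summable (\<lambda>j. 2 * (a ^ j * ?p j) + ?v j / a ^ j / e\<^sup>2)"
        by (intro summable_add summable_mult summable_divide summable_truncation_bounds int a)
      show "norm (prob (D j)) \<le> 2 * (a ^ j * ?p j) + ?v j / a ^ j / e\<^sup>2" for j
        using bound by simp
    qed
    then have "AE \<omega> in M. \<forall>\<^sub>F j in sequentially. \<omega> \<in> space M - D j"
      by (intro borel_cantelli_AE1) (auto simp: emeasure_eq_measure)
    then show ?thesis
      by (rule AE_mp) (auto simp: D_def e_def not_le elim!: eventually_mono intro!: AE_I2)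
  qed
  then have "AE \<omega> in M. \<forall>p. \<forall>\<^sub>F j in sequentially.
      \<bar>(\<Sum>i=1..k j. X i \<omega>) - real (k j) * m j\<bar> < 1 / real (Suc p) * real (k j)"
    by (simp add: AE_all_countable)
  then show ?thesis
  proof eventually_elim
    case (elim \<omega>)
    let ?S = "\<lambda>j. \<Sum>i=1..k j. X i \<omega>"
    have "(\<lambda>j. ?S j / real (k j) - m j) \<longlonglongrightarrow> 0"
    proof (rule tendstoI)
      fix r :: real assume "r > 0"
      then obtain p where p: "1 / real (Suc p) < r" using nat_approx_posE by blast
      from elim[rule_format, of p]
      show "\<forall>\<^sub>F j in sequentially. dist (?S j / real (k j) - m j) 0 < r"
      proof eventually_elim
        case (elim j)
        have kp: "real (k j) > 0" using k(3)[of j] by simp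
        have "?S j / real (k j) - m j = (?S j - real (k j) * m j) / real (k j)"
          using kp by (simp add: field_simps)
        then have "\<bar>?S j / real (k j) - m j\<bar> = \<bar>?S j - real (k j) * m j\<bar> / real (k j)"
          using kp by (simp add: abs_divide)
        also have "\<dots> < 1 / real (Suc p)"
          using elim kp by (simp only: pos_divide_less_eq)
        finally show ?case using p by (simp add: dist_real_def)
      qed
    qed
    from tendsto_add[OF this m_lim] have "(\<lambda>j. ?S j / real (k j)) \<longlonglongrightarrow> expectation X0" by simp
    \<comment> \<open>Since \<open>k j / a^j\<close> tends to 1, the denominator may be changed to
      the exact power required for the interpolation.\<close>
    from tendsto_mult[OF this k_ratio] have "(\<lambda>j. ?S j / real (k j) * (real (k j) / a ^ j)) \<longlonglongrightarrow> expectation X0"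
      by simp
    moreover have "?S j / real (k j) * (real (k j) / a ^ j) = ?S j / a ^ j" for j
      using k(3)[of j] by simp
    ultimately show ?case unfolding k_def by (simp only:)
  qed
qed

lemma (in prob_space) strong_law_nonneg:
  fixes X :: "nat \<Rightarrow> 'a \<Rightarrow> real" and X0 :: "'a \<Rightarrow> real"
  assumes indep: "indep_vars (\<lambda>_. borel) X {1..}"
    and int: "integrable M X0"
    and distr: "\<And>i. i \<ge> 1 \<Longrightarrow> distr M borel (X i) = distr M borel X0"
    and nonneg: "\<And>i \<omega>. 0 \<le> X i \<omega>"
  shows "AE \<omega> in M. (\<lambda>n. (\<Sum>i=1..n. X i \<omega>) / real n) \<longlonglongrightarrow> expectation X0"
proof -
  \<comment> \<open>Countably many ratios decreasing to 1, so one null set serves all of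
    them.\<close>
  define a where "a p = 1 + 1 / real (Suc p)" for p
  have "AE \<omega> in M. \<forall>p. (\<lambda>j. (\<Sum>i=1..nat \<lceil>a p ^ j\<rceil>. X i \<omega>) / a p ^ j) \<longlonglongrightarrow> expectation X0"
    unfolding AE_all_countable
    by (intro allI iid_sum_along_powers indep int distr) (auto simp: a_def)
  then show ?thesis
  proof eventually_elim
    case (elim \<omega>)
    show ?case
    proof (rule tendsto_divide_powers_imp_tendsto_divide_index[where A = "range a"])
      show "mono (\<lambda>n. \<Sum>i=1..n. X i \<omega>)"
        using nonneg by (intro monoI sum_mono2) auto
      show "\<exists>x\<in>range a. 1 < x \<and> x < r" if r: "r > 1" for r
      proof -
        obtain p where "1 / real (Suc p) < r - 1" using r nat_approx_posE[of "r - 1"] by auto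
        then show ?thesis by (intro bexI[of _ "a p"]) (auto simp: a_def)
      qed
    qed (use elim nonneg in \<open>auto intro: sum_nonneg\<close>)
  qed
qed

lemma distr_eq_compose:
  assumes "distr M N X = distr M N Y" "X \<in> measurable M N" "Y \<in> measurable M N"
    and "h \<in> measurable N L"
  shows "distr M L (\<lambda>\<omega>. h (X \<omega>)) = distr M L (\<lambda>\<omega>. h (Y \<omega>))"
  using distr_distr[OF assms(4,2)] distr_distr[OF assms(4,3)] assms(1) by (simp add: comp_def)

text \<open>Positive and negative parts are treated at once as \<open>max 0 (c * X)\<close> with
  \<open>c = 1\<close> and \<open>c = -1\<close>. Each family is again i.i.d. and nonnegative, and
  the two limits are subtracted.\<close>

lemma (in prob_space) strong_law_real:
  fixes X :: "nat \<Rightarrow> 'a \<Rightarrow> real" and X0 :: "'a \<Rightarrow> real"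
  assumes indep: "indep_vars (\<lambda>_. borel) X {1..}"
    and int: "integrable M X0"
    and distr: "\<And>i. i \<ge> 1 \<Longrightarrow> distr M borel (X i) = distr M borel X0"
  shows "AE \<omega> in M. (\<lambda>n. (\<Sum>i=1..n. X i \<omega>) / real n) \<longlonglongrightarrow> expectation X0"
proof -
  have X: "random_variable borel (X i)" if "i \<ge> 1" for i
    using indep that unfolding indep_vars_def by auto
  have part: "AE \<omega> in M. (\<lambda>n. (\<Sum>i=1..n. max 0 (c * X i \<omega>)) / real n) \<longlonglongrightarrow>
      expectation (\<lambda>\<omega>. max 0 (c * X0 \<omega>))" for c
  proof (rule strong_law_nonneg)
    show "indep_vars (\<lambda>_. borel) (\<lambda>i \<omega>. max 0 (c * X i \<omega>)) {1..}"
      by (rule indep_vars_compose2[OF indep]) measurable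
    show "distr M borel (\<lambda>\<omega>. max 0 (c * X i \<omega>)) = distr M borel (\<lambda>\<omega>. max 0 (c * X0 \<omega>))"
      if "i \<ge> 1" for i
      using int that by (intro distr_eq_compose[of M borel, OF distr X]) auto
  qed (use int in auto)
  have "expectation X0 = expectation (\<lambda>\<omega>. max 0 (1 * X0 \<omega>) - max 0 ((-1) * X0 \<omega>))"
    by (intro Bochner_Integration.integral_cong) auto
  also have "\<dots> = expectation (\<lambda>\<omega>. max 0 (1 * X0 \<omega>)) - expectation (\<lambda>\<omega>. max 0 ((-1) * X0 \<omega>))"
    using int by (intro Bochner_Integration.integral_diff) auto
  finally have E: "expectation (\<lambda>\<omega>. max 0 (1 * X0 \<omega>)) - expectation (\<lambda>\<omega>. max 0 ((-1) * X0 \<omega>)) =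
    expectation X0" by simp
  have S: "(\<Sum>i=1..n. max 0 (1 * X i \<omega>)) / real n - (\<Sum>i=1..n. max 0 ((-1) * X i \<omega>)) / real n =
      (\<Sum>i=1..n. X i \<omega>) / real n" for n \<omega>
    unfolding diff_divide_distrib[symmetric] sum_subtractf[symmetric]
    by (intro arg_cong2[of _ _ _ _ "(/)"] sum.cong) auto
  from part[of 1] part[of "-1"] show ?thesis
  proof eventually_elim
    case (elim \<omega>)
    from tendsto_diff[OF elim] show ?case unfolding E S .
  qed
qed

text \<open>Convergence is tested on the coordinates, and the finitely many null sets are
  united.\<close>

lemma (in prob_space) strong_law_of_large_numbers:
  fixes X :: "nat \<Rightarrow> 'a \<Rightarrow> 'b::euclidean_space" and X0 :: "'a \<Rightarrow> 'b"
  assumes indep: "indep_vars (\<lambda>_. borel) X {1..}"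
    and int: "integrable M X0"
    and distr: "\<And>i. i \<ge> 1 \<Longrightarrow> distr M borel (X i) = distr M borel X0"
  shows "AE \<omega> in M. (\<lambda>n. (\<Sum>i=1..n. X i \<omega>) /\<^sub>R real n) \<longlonglongrightarrow> expectation X0"
proof -
  have X: "random_variable borel (X i)" if "i \<ge> 1" for i
    using indep that unfolding indep_vars_def by auto
  have "AE \<omega> in M. (\<lambda>n. (\<Sum>i=1..n. X i \<omega> \<bullet> b) / real n) \<longlonglongrightarrow> expectation (\<lambda>\<omega>. X0 \<omega> \<bullet> b)" for b
  proof (rule strong_law_real)
    show "indep_vars (\<lambda>_. borel) (\<lambda>i \<omega>. X i \<omega> \<bullet> b) {1..}"
      by (rule indep_vars_compose2[OF indep]) measurable
    show "distr M borel (\<lambda>\<omega>. X i \<omega> \<bullet> b) = distr M borel (\<lambda>\<omega>. X0 \<omega> \<bullet> b)" if "i \<ge> 1" for i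
      using int that by (intro distr_eq_compose[of M borel, OF distr X]) auto
  qed (use int in auto)
  then have "AE \<omega> in M. \<forall>b\<in>Basis.
      (\<lambda>n. (\<Sum>i=1..n. X i \<omega> \<bullet> b) / real n) \<longlonglongrightarrow> expectation (\<lambda>\<omega>. X0 \<omega> \<bullet> b)"
    by (intro AE_finite_allI) auto
  then show ?thesis
  proof eventually_elim
    case (elim \<omega>)
    then show ?case
      using int
      by (subst tendsto_componentwise_iff) (simp add: inner_sum_left divide_inverse mult.commute)
  qed
qed

subsection \<open>Convergence of the convex hulls\<close>

theorem theorem6p3:
  fixes M :: "'w measure"
    and \<xi> :: "'w \<Rightarrow> real ^ 'd"
    and \<xi>s :: "nat \<Rightarrow> 'w \<Rightarrow> real ^ 'd"
    and \<mu> :: "real ^ 'd"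
  assumes "prob_space M"
    and "\<xi> \<in> borel_measurable M"
    and "prob_space.indep_vars M (\<lambda>_. borel) \<xi>s {1..}"
    and "\<And>i. i \<ge> 1 \<Longrightarrow> distr M borel (\<xi>s i) = distr M borel \<xi>"
    and "integrable M (\<lambda>\<omega>. norm (\<xi> \<omega>))"
    and "integral\<^sup>L M \<xi> = \<mu>"
  shows "as_tendsto_in M convex_compact0 hausdorff_dist (scaled_walk_hull \<xi>s) (drift_segment \<mu>)"
proof -
  have "integrable M \<xi>" using assms(2,5) by (simp add: integrable_norm_iff)
  from prob_space.strong_law_of_large_numbers[OF assms(1,3) this assms(4)]
  have "AE \<omega> in M. (\<lambda>n. random_walk \<xi>s n \<omega> /\<^sub>R real n) \<longlonglongrightarrow> \<mu>"
    by (simp add: assms(6) random_walk_def)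
  then have "AE \<omega> in M. (\<lambda>n. hausdorff_dist (scaled_walk_hull \<xi>s n \<omega>) (drift_segment \<mu>)) \<longlonglongrightarrow> 0"
    by eventually_elim (rule hausdorff_dist_scaled_walk_hull_tendsto)
  \<comment> \<open>Membership in \<open>convex_compact0\<close> holds at every
    \<open>\<omega>\<close>, as \<open>as_tendsto_in\<close> demands; only the convergence is almost
    sure.\<close>
  then show ?thesis
    by (simp add: as_tendsto_in_def scaled_walk_hull_in_convex_compact0
        drift_segment_in_convex_compact0)
qed

end
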